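(* Let $\mathbf{f}\in L_2(\mathbb{D},\mathbb{R}^t)$, and let $\mathcal{N}^*_{k_i}$, $\mathbf{f}_i$ and $\mathbf{e}^*_i$, $i\in\mathbb{N}$, be respectively the networks, the learned functions and the optimal errors produced by the multi-grade learning model applied to $\mathbf{f}$ (as defined in the context). The following statements hold: (i) For all $l\in\mathbb{N}$, $$\mathbf{f}(\mathbf{x})=\sum_{i=1}^l(\mathcal{N}^*_{k_i}\circ\mathcal{N}^*_{k_{i-1}}\circ\cdots\circ\mathcal{N}^*_{k_1})(\mathbf{x})+\mathbf{e}^*_l(\mathbf{x}),\qquad \mathbf{x}\in\mathbb{D}.$$ (ii) For all $i\in\mathbb{N}$, $$\|\mathbf{e}^*_i\|^2\ \geq\ \|\mathbf{f}_{i+1}\|^2+\|\mathbf{e}^*_{i+1}\|^2 .$$ (iii) For all $i\in\mathbb{N}$, $\|\mathbf{e}^*_{i+1}\|\leq\|\mathbf{e}^*_i\|$, and the sequence $\|\mathbf{e}^*_i\|$, $i\in\mathbb{N}$, has a nonnegative limit. (iv) For each $i\in\mathbb{N}$, either $\mathbf{f}_{i+1}=\mathbf{0}$ (as an element of $L_2(\mathbb{D},\mathbb{R}^t)$) or $\|\mathbf{e}^*_{i+1}\|<\|\mathbf{e}^*_i\|$.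
   Context: Let $s,t\in\mathbb{N}=\{1,2,\dots\}$, $\mathbb{N}_n:=\{1,\dots,n\}$, and let $\mathbb{D}\subseteq\mathbb{R}^s$ be a measurable set. $L_2(\mathbb{D},\mathbb{R}^t)$ is the real Hilbert space of functions $\mathbf{g}=[g_1,\dots,g_t]^\top:\mathbb{D}\to\mathbb{R}^t$ with $\|\mathbf{g}\|:=\big(\sum_{j=1}^t\int_{\mathbb{D}}|g_j(\mathbf{x})|^2d\mathbf{x}\big)^{1/2}<\infty$ and inner product $\langle\mathbf{f},\mathbf{g}\rangle:=\sum_{j=1}^t\int_{\mathbb{D}}f_j(\mathbf{x})g_j(\mathbf{x})\,d\mathbf{x}$. (For a measurable function not in this space, $\|\cdot\|=\infty$.) Neural networks. Fix a (measurable) activation function $\sigma:\mathbb{R}\to\mathbb{R}$, applied componentwise to vectors. For $n\in\mathbb{N}$, widths $m_0,\dots,m_n\in\mathbb{N}$, weight matrices $\mathbf{W}_j\in\mathbb{R}^{m_j\times m_{j-1}}$ and bias vectors $\mathbf{b}_j\in\mathbb{R}^{m_j}$, $j\in\mathbb{N}_n$, the $n$-layer network is the function $\mathbb{R}^{m_0}\to\mathbb{R}^{m_n}$ $$\mathcal{N}_n(\{\mathbf{W}_j,\mathbf{b}_j\}_{j=1}^n;\mathbf{x}):=\mathbf{W}_n\,(h_{n-1}\circ\cdots\circ h_1)(\mathbf{x})+\mathbf{b}_n,\qquad h_j(\mathbf{z}):=\sigma(\mathbf{W}_j\mathbf{z}+\mathbf{b}_j),$$ i.e. the output (last) layer is affine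 with no activation (for $n=1$ the composition is the identity). Multi-grade learning model. Fix depths $k_i\in\mathbb{N}$, $i\in\mathbb{N}$, and for each grade $i$ a set of widths $m_0,\dots,m_{k_i}$ (possibly depending on $i$) with $m_0=s$ for grade $1$, $m_0=t$ for grades $i\ge2$, and $m_{k_i}=t$ for every $i$. The networks, functions and errors are defined successively. Grade 1: let $\{\mathbf{W}^*_{1,j},\mathbf{b}^*_{1,j}\}_{j=1}^{k_1}$ be a (global) minimizer of $\|\mathbf{f}-\mathcal{N}_{k_1}(\{\mathbf{W}_j,\mathbf{b}_j\}_{j=1}^{k_1};\cdot)\|^2$ over all $\mathbf{W}_j\in\mathbb{R}^{m_j\times m_{j-1}}$, $\mathbf{b}_j\in\mathbb{R}^{m_j}$; put $\mathcal{N}^*_{k_1}:=\mathcal{N}_{k_1}(\{\mathbf{W}^*_{1,j},\mathbf{b}^*_{1,j}\}_{j=1}^{k_1};\cdot)$, $\mathbf{f}_1:=\mathcal{N}^*_{k_1}$ and $\mathbf{e}^*_1:=\mathbf{f}-\mathbf{f}_1$. Grade $i+1$, $i\ge1$: with $\mathcal{N}^*_{k_1},\dots,\mathcal{N}^*_{k_i}$ and $\mathbf{e}^*_i$ already determined and kept fixed, let $\{\mathbf{W}^*_{i+1,j},\mathbf{b}^*_{i+1,j}\}_{j=1}^{k_{i+1}}$ be a (global) minimizer of $$\big\|\mathbf{e}^*_i-\mathcal{N}_{k_{i+1}}(\{\mathbf{W}_j,\mathbf{b}_j\}_{j=1}^{k_{i+1}};\cdot)\circ\mathcal{N}^*_{k_i}\circ\cdots\circ\mathcal{N}^*_{k_1}\big\|^2$$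 over all $\mathbf{W}_j\in\mathbb{R}^{m_j\times m_{j-1}}$, $\mathbf{b}_j\in\mathbb{R}^{m_j}$, $j\in\mathbb{N}_{k_{i+1}}$; put $\mathcal{N}^*_{k_{i+1}}:=\mathcal{N}_{k_{i+1}}(\{\mathbf{W}^*_{i+1,j},\mathbf{b}^*_{i+1,j}\}_{j=1}^{k_{i+1}};\cdot)$, $\mathbf{f}_{i+1}:=\mathcal{N}^*_{k_{i+1}}\circ\mathcal{N}^*_{k_i}\circ\cdots\circ\mathcal{N}^*_{k_1}$ and $\mathbf{e}^*_{i+1}:=\mathbf{e}^*_i-\mathbf{f}_{i+1}$. It is a standing assumption that all these minimizers exist (the model is defined through them). All functions are regarded as restricted to $\mathbb{D}$. *)

theory Defs
  imports "HOL-Analysis.Analysis" "Jordan_Normal_Form.Matrix"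
begin

text \<open>
  Layer widths are arbitrary and vary from layer to layer, so networks act on the
  dimension-free vectors and matrices of \<^theory>\<open>Jordan_Normal_Form.Matrix\<close>.  Integration takes
  place on \<open>real ^ 's\<close>.  The two representations are identified through the canonical enumeration
  \<open>from_nat_into UNIV\<close>, \<open>to_nat_on UNIV\<close> of the finite index type.
\<close>

no_notation vec_index (infixl \<open>$\<close> 100)

definition to_vec :: "real ^ 'n \<Rightarrow> real Matrix.vec" where
  "to_vec x = Matrix.vec CARD('n) (\<lambda>i. x $ from_nat_into (UNIV :: 'n set) i)"

definition of_vec :: "real Matrix.vec \<Rightarrow> real ^ 'n" where
  "of_vec v = (\<chi> i. vec_index v (to_nat_on (UNIV :: 'n set) i))"

lemma to_vec_carrier: "to_vec (x :: real ^ 'n) \<in> carrier_vec CARD('n)"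
  by (simp add: to_vec_def)

lemma to_nat_on_less_CARD: "to_nat_on (UNIV :: 'n::finite set) i < CARD('n)"
  using bij_betwE[OF to_nat_on_finite[of "UNIV :: 'n set"]] by auto

lemma of_vec_to_vec: "of_vec (to_vec x) = (x :: real ^ 'n)"
  by (simp add: of_vec_def to_vec_def vec_eq_iff to_nat_on_less_CARD)

lemma to_vec_of_vec:
  assumes "v \<in> carrier_vec CARD('n)"
  shows "to_vec (of_vec v :: real ^ 'n) = v"
proof (rule eq_vecI)
  fix i assume "i < dim_vec v"
  hence i: "i < CARD('n)" using assms by simp
  have "i \<in> to_nat_on (UNIV :: 'n set) ` UNIV"
    using i bij_betw_imp_surj_on[OF to_nat_on_finite[of "UNIV :: 'n set"]] by auto
  thus "vec_index (to_vec (of_vec v :: real ^ 'n)) i = vec_index v i"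
    using i by (simp add: to_vec_def of_vec_def)
qed (use assms in \<open>simp add: to_vec_def\<close>)


definition sq_integral :: "(real ^ 's) set \<Rightarrow> (real ^ 's \<Rightarrow> real ^ 't) \<Rightarrow> ennreal" where
  "sq_integral D g = (\<Sum>j\<in>UNIV. \<integral>\<^sup>+ x. ennreal (\<bar>g x $ j\<bar>\<^sup>2) \<partial>lebesgue_on D)"

text \<open>The extended norm: it is \<open>\<infinity>\<close> for measurable functions outside \<open>L\<^sub>2\<close>.\<close>

definition l2norm :: "(real ^ 's) set \<Rightarrow> (real ^ 's \<Rightarrow> real ^ 't) \<Rightarrow> ennreal" where
  "l2norm D g =
     (if sq_integral D g = \<infinity> then \<infinity> else ennreal (sqrt (enn2real (sq_integral D g))))"

definition l2_space :: "(real ^ 's) set \<Rightarrow> (real ^ 's \<Rightarrow> real ^ 't) set" where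
  "l2_space D = {g. g \<in> borel_measurable (lebesgue_on D) \<and> l2norm D g < \<infinity>}"


text \<open>Layers are numbered from 1; \<open>hidden \<sigma> W b j\<close> is the composition of the first \<open>j\<close> of them.\<close>

primrec hidden :: "(real \<Rightarrow> real) \<Rightarrow> (nat \<Rightarrow> real mat) \<Rightarrow> (nat \<Rightarrow> real Matrix.vec) \<Rightarrow>
    nat \<Rightarrow> real Matrix.vec \<Rightarrow> real Matrix.vec" where
  "hidden \<sigma> W b 0 z = z"
| "hidden \<sigma> W b (Suc j) z = map_vec \<sigma> (W (Suc j) *\<^sub>v hidden \<sigma> W b j z + b (Suc j))"

definition network :: "(real \<Rightarrow> real) \<Rightarrow> nat \<Rightarrow> (nat \<Rightarrow> real mat) \<Rightarrow> (nat \<Rightarrow> real Matrix.vec) \<Rightarrow>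
    real Matrix.vec \<Rightarrow> real Matrix.vec" where
  "network \<sigma> n W b x = W n *\<^sub>v hidden \<sigma> W b (n - 1) x + b n"

definition network_params ::
    "nat \<Rightarrow> (nat \<Rightarrow> nat) \<Rightarrow> (nat \<Rightarrow> real mat) \<Rightarrow> (nat \<Rightarrow> real Matrix.vec) \<Rightarrow> bool" where
  "network_params n m W b \<longleftrightarrow>
     (\<forall>j\<in>{1..n}. W j \<in> carrier_mat (m j) (m (j - 1)) \<and> b j \<in> carrier_vec (m j))"


text \<open>
  Grades are numbered from 1.  Grade \<open>i\<close> has depth \<open>k i\<close>, widths \<open>m i 0, \<dots>, m i (k i)\<close> and learned
  parameters \<open>W i j\<close>, \<open>b i j\<close> for \<open>1 \<le> j \<le> k i\<close>.  The value at index 0 is the start of the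
  recursion (empty composition, error \<open>f\<close>), which makes the first grade an instance of the
  general one.
\<close>

primrec net_chain :: "(real \<Rightarrow> real) \<Rightarrow> (nat \<Rightarrow> nat) \<Rightarrow> (nat \<Rightarrow> nat \<Rightarrow> real mat) \<Rightarrow>
    (nat \<Rightarrow> nat \<Rightarrow> real Matrix.vec) \<Rightarrow> nat \<Rightarrow> real Matrix.vec \<Rightarrow> real Matrix.vec" where
  "net_chain \<sigma> k W b 0 = id"
| "net_chain \<sigma> k W b (Suc i) = network \<sigma> (k (Suc i)) (W (Suc i)) (b (Suc i)) \<circ> net_chain \<sigma> k W b i"

definition learned :: "(real \<Rightarrow> real) \<Rightarrow> (nat \<Rightarrow> nat) \<Rightarrow> (nat \<Rightarrow> nat \<Rightarrow> real mat) \<Rightarrow>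
    (nat \<Rightarrow> nat \<Rightarrow> real Matrix.vec) \<Rightarrow> nat \<Rightarrow> real ^ 's \<Rightarrow> real ^ 't" where
  "learned \<sigma> k W b i x = of_vec (net_chain \<sigma> k W b i (to_vec x))"

primrec grade_error :: "(real \<Rightarrow> real) \<Rightarrow> (nat \<Rightarrow> nat) \<Rightarrow> (nat \<Rightarrow> nat \<Rightarrow> real mat) \<Rightarrow>
    (nat \<Rightarrow> nat \<Rightarrow> real Matrix.vec) \<Rightarrow> (real ^ 's \<Rightarrow> real ^ 't) \<Rightarrow> nat \<Rightarrow> real ^ 's \<Rightarrow> real ^ 't" where
  "grade_error \<sigma> k W b f 0 = f"
| "grade_error \<sigma> k W b f (Suc i) = (\<lambda>x. grade_error \<sigma> k W b f i x - learned \<sigma> k W b (Suc i) x)"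

definition grade_loss :: "(real ^ 's) set \<Rightarrow> (real \<Rightarrow> real) \<Rightarrow> (nat \<Rightarrow> nat) \<Rightarrow>
    (nat \<Rightarrow> nat \<Rightarrow> real mat) \<Rightarrow> (nat \<Rightarrow> nat \<Rightarrow> real Matrix.vec) \<Rightarrow> (real ^ 's \<Rightarrow> real ^ 't) \<Rightarrow> nat \<Rightarrow>
    (nat \<Rightarrow> real mat) \<Rightarrow> (nat \<Rightarrow> real Matrix.vec) \<Rightarrow> ennreal" where
  "grade_loss D \<sigma> k W b f i V c =
     (l2norm D (\<lambda>x. grade_error \<sigma> k W b f i x
        - of_vec (network \<sigma> (k (Suc i)) V c (net_chain \<sigma> k W b i (to_vec x)))))\<^sup>2"

definition multigrade_model :: "(real ^ 's) set \<Rightarrow> (real \<Rightarrow> real) \<Rightarrow> (nat \<Rightarrow> nat) \<Rightarrow>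
    (nat \<Rightarrow> nat \<Rightarrow> nat) \<Rightarrow> (real ^ 's \<Rightarrow> real ^ 't) \<Rightarrow>
    (nat \<Rightarrow> nat \<Rightarrow> real mat) \<Rightarrow> (nat \<Rightarrow> nat \<Rightarrow> real Matrix.vec) \<Rightarrow> bool" where
  "multigrade_model D \<sigma> k m f W b \<longleftrightarrow>
     (\<forall>i. network_params (k (Suc i)) (m (Suc i)) (W (Suc i)) (b (Suc i)) \<and>
       (\<forall>V c. network_params (k (Suc i)) (m (Suc i)) V c \<longrightarrow>
          grade_loss D \<sigma> k W b f i (W (Suc i)) (b (Suc i)) \<le> grade_loss D \<sigma> k W b f i V c))"

end

theory Submission
  imports Defs
begin

text \<open>
  The output layer is affine, so the networks available in one grade are closed under scaling by
  reals.  Minimality of \<open>e - h\<close> against the competitors \<open>e - (1 - a) h\<close>, \<open>0 < a < 1\<close>, bounds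
  \<open>\<parallel>e - h\<parallel>\<^sup>2\<close> by a norm which the convexity identity
  \<open>\<parallel>(1 - a) u + a v\<parallel>\<^sup>2 + a (1 - a) \<parallel>u - v\<parallel>\<^sup>2 = (1 - a) \<parallel>u\<parallel>\<^sup>2 + a \<parallel>v\<parallel>\<^sup>2\<close> evaluates at
  \<open>u = e - h\<close>, \<open>v = e\<close>.  Dividing by \<open>a\<close> and letting \<open>a\<close> tend to 0 gives
  \<open>\<parallel>e - h\<parallel>\<^sup>2 + \<parallel>h\<parallel>\<^sup>2 \<le> \<parallel>e\<parallel>\<^sup>2\<close>, from which the remaining claims follow.
\<close>

section \<open>Squared integrals and the variational inequality\<close>

lemma l2norm_power2: "(l2norm D g)\<^sup>2 = sq_integral D g"
proof (cases "sq_integral D g = \<infinity>")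
  case True
  thus ?thesis by (simp add: l2norm_def power2_eq_square ennreal_mult_eq_top_iff)
next
  case False
  thus ?thesis
    by (simp add: l2norm_def ennreal_power ennreal_enn2real less_top)
qed

lemma l2norm_finite_iff: "l2norm D g \<noteq> \<infinity> \<longleftrightarrow> sq_integral D g \<noteq> \<infinity>"
  by (auto simp: l2norm_def less_top)

text \<open>The extended square root preserves and reflects order, so norm comparisons reduce to
  comparisons of integrals.\<close>

lemma l2norm_le_iff: "l2norm D g \<le> l2norm D h \<longleftrightarrow> sq_integral D g \<le> sq_integral D h"
  unfolding l2norm_def
  by (auto simp: top_unique less_top)
    (metis enn2real_mono ennreal_enn2real ennreal_leI infinity_ennreal_def less_top)+

lemma l2norm_less_iff: "l2norm D g < l2norm D h \<longleftrightarrow> sq_integral D g < sq_integral D h"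
  by (simp add: l2norm_le_iff flip: not_le)

text \<open>A pointwise quadratic identity, integrated coordinate by coordinate. With all terms
  added rather than subtracted, it makes sense in \<open>ennreal\<close> even for infinite
  integrals.\<close>

lemma sq_integral_convex_combination:
  assumes "\<And>j. (\<lambda>x. u x $ j) \<in> borel_measurable (lebesgue_on D)"
    and "\<And>j. (\<lambda>x. v x $ j) \<in> borel_measurable (lebesgue_on D)"
    and "0 \<le> a" "a \<le> 1"
  shows "sq_integral D (\<lambda>x. (1 - a) *\<^sub>R u x + a *\<^sub>R v x)
      + ennreal (a * (1 - a)) * sq_integral D (\<lambda>x. u x - v x)
    = ennreal (1 - a) * sq_integral D u + ennreal a * sq_integral D v"
proof -
  have *: "ennreal (\<bar>((1 - a) *\<^sub>R u x + a *\<^sub>R v x) $ j\<bar>\<^sup>2)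
      + ennreal (a * (1 - a)) * ennreal (\<bar>(u x - v x) $ j\<bar>\<^sup>2)
    = ennreal (1 - a) * ennreal (\<bar>u x $ j\<bar>\<^sup>2) + ennreal a * ennreal (\<bar>v x $ j\<bar>\<^sup>2)" for x j
  proof -
    have "((1 - a) * p + a * q)\<^sup>2 + a * (1 - a) * (p - q)\<^sup>2 = (1 - a) * p\<^sup>2 + a * q\<^sup>2" for p q :: real
      by (simp add: power2_eq_square algebra_simps)
    thus ?thesis using assms(3,4) by (simp flip: ennreal_mult ennreal_plus)
  qed
  note [measurable] = assms(1,2)
  show ?thesis
    unfolding sq_integral_def
    by (simp add: sum_distrib_left *[simplified] flip: nn_integral_cmult nn_integral_add sum.distrib)
qed

lemma sq_integral_pythagoras_le:
  fixes e h :: "real ^ 's \<Rightarrow> real ^ 't"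
  assumes e: "\<And>j. (\<lambda>x. e x $ j) \<in> borel_measurable (lebesgue_on D)"
    and h: "\<And>j. (\<lambda>x. h x $ j) \<in> borel_measurable (lebesgue_on D)"
    and fin: "sq_integral D e < \<infinity>"
    and min: "\<And>a. sq_integral D (\<lambda>x. e x - h x) \<le> sq_integral D (\<lambda>x. e x - a *\<^sub>R h x)"
  shows "sq_integral D h + sq_integral D (\<lambda>x. e x - h x) \<le> sq_integral D e"
proof -
  let ?u = "\<lambda>x. e x - h x"
  have u: "(\<lambda>x. ?u x $ j) \<in> borel_measurable (lebesgue_on D)" for j
    using e[of j] h[of j] by simp
  have neg: "sq_integral D (\<lambda>x. ?u x - e x) = sq_integral D h"
    by (simp add: sq_integral_def)
  have comb: "(1 - a) *\<^sub>R ?u x + a *\<^sub>R e x = e x - (1 - a) *\<^sub>R h x" for a x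
    by (simp add: algebra_simps)
  have conv: "sq_integral D (\<lambda>x. e x - (1 - a) *\<^sub>R h x) + ennreal (a * (1 - a)) * sq_integral D h
    = ennreal (1 - a) * sq_integral D ?u + ennreal a * sq_integral D e" if "0 \<le> a" "a \<le> 1" for a
    using sq_integral_convex_combination[OF u e that] unfolding neg comb .
  \<comment> \<open>The factor 0 compares \<open>e - h\<close> with \<open>e\<close> itself.\<close>
  have finu: "sq_integral D ?u < \<infinity>"
    using min[of 0] fin by (simp add: le_less_trans)
  \<comment> \<open>At \<open>a = 1/2\<close> the coefficient of \<open>sq_integral D h\<close> is
    1/4, hence positive, so the finite right-hand side forces \<open>h\<close> to be square
    integrable.\<close>
  have "ennreal (1/2 * (1 - 1/2)) * sq_integral D h
      \<le> ennreal (1 - 1/2) * sq_integral D ?u + ennreal (1/2) * sq_integral D e"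
    by (subst conv[of "1/2", symmetric]) (auto intro: add_increasing)
  also have "\<dots> < \<infinity>"
    using fin finu ennreal_less_top[of "1/2"] by (simp add: ennreal_mult_less_top)
  finally have finh: "sq_integral D h < \<infinity>"
    by (auto simp: ennreal_mult_less_top)
  \<comment> \<open>All three integrals are finite; real values allow cancelling \<open>U\<close>
    and dividing by \<open>a\<close>.\<close>
  obtain U where U: "sq_integral D ?u = ennreal U" "0 \<le> U"
    using finu by (cases "sq_integral D ?u") auto
  obtain E where E: "sq_integral D e = ennreal E" "0 \<le> E"
    using fin by (cases "sq_integral D e") auto
  obtain H where H: "sq_integral D h = ennreal H" "0 \<le> H"
    using finh by (cases "sq_integral D h") auto
  \<comment> \<open>Minimality at the factor \<open>1 - a\<close> gives
    \<open>U + a * (1 - a) * H\<close> \<le> \<open>(1 - a) * U + a * E\<close>; once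
    \<open>(1 - a) * U\<close> is cancelled, every term carries the factor \<open>a\<close>.\<close>
  have "U + (1 - a) * H \<le> E" if a: "0 < a" "a < 1" for a
  proof -
    have "ennreal U + ennreal (a * (1 - a)) * ennreal H
        \<le> sq_integral D (\<lambda>x. e x - (1 - a) *\<^sub>R h x) + ennreal (a * (1 - a)) * sq_integral D h"
      using min[of "1 - a"] unfolding U H by (rule add_right_mono)
    also have "\<dots> = ennreal (1 - a) * ennreal U + ennreal a * ennreal E"
      using conv[of a] a unfolding U E by simp
    finally have "ennreal (U + a * (1 - a) * H) \<le> ennreal ((1 - a) * U + a * E)"
      using a U(2) E(2) H(2) by (simp add: ennreal_mult ennreal_plus)
    hence "U + a * (1 - a) * H \<le> (1 - a) * U + a * E"
      using a U(2) E(2) by (subst (asm) ennreal_le_iff) auto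
    hence "a * (U + (1 - a) * H) \<le> a * E" by (simp add: algebra_simps)
    thus ?thesis using a by simp
  qed
  hence ev: "eventually (\<lambda>a. U + (1 - a) * H \<le> E) (at_right (0::real))"
    unfolding eventually_at_right_field by (intro exI[of _ 1]) auto
  have "((\<lambda>a. U + (1 - a) * H) \<longlongrightarrow> U + (1 - 0) * H) (at_right (0::real))"
    by (intro tendsto_intros)
  hence "U + H \<le> E" using tendsto_upperbound[OF _ ev] by simp
  thus ?thesis using U E H by (simp add: add.commute flip: ennreal_plus)
qed

lemma sq_integral_eq_0_imp_AE:
  fixes h :: "real ^ 's \<Rightarrow> real ^ 't"
  assumes "\<And>j. (\<lambda>x. h x $ j) \<in> borel_measurable (lebesgue_on D)" and "sq_integral D h = 0"
  shows "AE x in lebesgue_on D. h x = 0"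
proof -
  note [measurable] = assms(1)
  have "AE x in lebesgue_on D. h x $ j = 0" for j
    using assms(2) by (simp add: sq_integral_def nn_integral_0_iff_AE)
  hence "AE x in lebesgue_on D. \<forall>j\<in>UNIV. h x $ j = 0"
    by (intro AE_finite_allI) auto
  thus ?thesis by (rule eventually_mono) (auto simp: Finite_Cartesian_Product.vec_eq_iff zero_index)
qed

section \<open>Measurability of networks\<close>

text \<open>Measurability is coordinatewise because the dimension changes from layer to layer within
  one type; \<open>n\<close> records the current width.\<close>

definition vec_measurable :: "nat \<Rightarrow> 'a measure \<Rightarrow> ('a \<Rightarrow> real Matrix.vec) \<Rightarrow> bool" where
  "vec_measurable n M F \<longleftrightarrow>
     (\<forall>x. F x \<in> carrier_vec n) \<and> (\<forall>i<n. (\<lambda>x. vec_index (F x) i) \<in> borel_measurable M)"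

lemma vec_measurable_affine:
  assumes F: "vec_measurable n M F" and A: "A \<in> carrier_mat p n" and c: "c \<in> carrier_vec p"
  shows "vec_measurable p M (\<lambda>x. A *\<^sub>v F x + c)"
  unfolding vec_measurable_def
proof (intro conjI allI impI)
  show "A *\<^sub>v F x + c \<in> carrier_vec p" for x
    using A c by (intro add_carrier_vec mult_mat_vec_carrier) (use F in \<open>auto simp: vec_measurable_def\<close>)
  fix i assume i: "i < p"
  have "vec_index (A *\<^sub>v F x + c) i = (\<Sum>l<n. A $$ (i, l) * vec_index (F x) l) + vec_index c i" for x
  proof -
    have "F x \<in> carrier_vec n" using F by (simp add: vec_measurable_def)
    thus ?thesis using A c i by (simp add: scalar_prod_def atLeast0LessThan)
  qed
  moreover have "(\<lambda>x. vec_index (F x) l) \<in> borel_measurable M" if "l < n" for l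
    using F that by (simp add: vec_measurable_def)
  ultimately show "(\<lambda>x. vec_index (A *\<^sub>v F x + c) i) \<in> borel_measurable M"
    by simp
qed

lemma vec_measurable_map_vec:
  assumes "\<sigma> \<in> borel_measurable borel" and "vec_measurable n M F"
  shows "vec_measurable n M (\<lambda>x. map_vec \<sigma> (F x))"
proof -
  have "vec_index (map_vec \<sigma> (F x)) i = \<sigma> (vec_index (F x) i)" if "i < n" for i x
    using assms(2) that by (metis carrier_vecD index_map_vec(1) vec_measurable_def)
  thus ?thesis
    using assms by (auto simp: vec_measurable_def intro: measurable_compose)
qed

lemma vec_measurable_hidden:
  assumes "\<sigma> \<in> borel_measurable borel" and "network_params n m V c"
    and "vec_measurable (m 0) M F" and "j \<le> n"
  shows "vec_measurable (m j) M (\<lambda>x. hidden \<sigma> V c j (F x))"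
  using assms(4)
proof (induction j)
  case 0
  thus ?case using assms(3) by simp
next
  case (Suc j)
  hence "V (Suc j) \<in> carrier_mat (m (Suc j)) (m j)" "c (Suc j) \<in> carrier_vec (m (Suc j))"
    using assms(2) by (force simp: network_params_def)+
  thus ?case using Suc assms(1) by (simp add: vec_measurable_map_vec vec_measurable_affine)
qed

lemma vec_measurable_network:
  assumes "\<sigma> \<in> borel_measurable borel" and "network_params n m V c"
    and "vec_measurable (m 0) M F" and "1 \<le> n"
  shows "vec_measurable (m n) M (\<lambda>x. network \<sigma> n V c (F x))"
proof -
  have "V n \<in> carrier_mat (m n) (m (n - 1))" "c n \<in> carrier_vec (m n)"
    using assms(2,4) by (auto simp: network_params_def)
  thus ?thesis
    unfolding network_def using vec_measurable_hidden[OF assms(1-3), of "n - 1"]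
    by (simp add: vec_measurable_affine)
qed

section \<open>Scaling the output of a network\<close>

lemma hidden_cong:
  assumes "\<And>l. 1 \<le> l \<Longrightarrow> l \<le> j \<Longrightarrow> V l = V' l" "\<And>l. 1 \<le> l \<Longrightarrow> l \<le> j \<Longrightarrow> c l = c' l"
  shows "hidden \<sigma> V c j z = hidden \<sigma> V' c' j z"
  using assms by (induction j) auto

text \<open>A case split suffices: for positive \<open>j\<close> the parameters of layer
  \<open>j\<close> alone fix the dimension of its output.\<close>

lemma hidden_carrier:
  assumes "network_params n m V c" and "z \<in> carrier_vec (m 0)" and "j \<le> n"
  shows "hidden \<sigma> V c j z \<in> carrier_vec (m j)"
  using assms by (cases j) (auto simp: network_params_def intro!: carrier_vecI)

text \<open>No activation follows the output layer, so multiplying its matrix and bias by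
  \<open>a\<close> multiplies the network by \<open>a\<close>. This supplies the competitors in each
  grade; \<open>a = 0\<close> gives the zero function.\<close>

lemma network_scale:
  assumes "network_params n m V c" and "1 \<le> n"
  obtains V' c' where "network_params n m V' c'"
    and "\<And>z. z \<in> carrier_vec (m 0) \<Longrightarrow> network \<sigma> n V' c' z = a \<cdot>\<^sub>v network \<sigma> n V c z"
proof
  let ?V = "V(n := a \<cdot>\<^sub>m V n)" and ?c = "c(n := a \<cdot>\<^sub>v c n)"
  have n: "V n \<in> carrier_mat (m n) (m (n - 1))" "c n \<in> carrier_vec (m n)"
    using assms by (auto simp: network_params_def)
  show "network_params n m ?V ?c"
    using assms by (auto simp: network_params_def)
  fix z :: "real Matrix.vec" assume z: "z \<in> carrier_vec (m 0)"
  \<comment> \<open>The hidden part reads layers 1 to \<open>n - 1\<close> only, so the update at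
    \<open>n\<close> is invisible to it.\<close>
  have hid: "hidden \<sigma> ?V ?c (n - 1) z = hidden \<sigma> V c (n - 1) z"
    using assms(2) by (intro hidden_cong) auto
  have "hidden \<sigma> V c (n - 1) z \<in> carrier_vec (m (n - 1))"
    using hidden_carrier[OF assms(1) z] by simp
  thus "network \<sigma> n ?V ?c z = a \<cdot>\<^sub>v network \<sigma> n V c z"
    unfolding network_def hid using n
    by (intro eq_vecI) (auto simp: algebra_simps)
qed

section \<open>Passage between the two vector representations\<close>

lemma vec_measurable_to_vec:
  "vec_measurable CARD('n) (lebesgue_on D) (to_vec :: real ^ 'n \<Rightarrow> real Matrix.vec)"
proof -
  \<comment> \<open>Coordinate projections are Borel, hence Lebesgue measurable, and remain
    measurable on \<open>D\<close>.\<close>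
  have "(\<lambda>x :: real ^ 'n. x $ i) \<in> borel_measurable (lebesgue_on D)" for i
    by (intro measurable_restrict_space1 measurable_completion) simp
  thus ?thesis
    by (auto simp: vec_measurable_def to_vec_carrier) (simp add: to_vec_def)
qed

lemma of_vec_smult:
  assumes "v \<in> carrier_vec CARD('n)"
  shows "(of_vec (a \<cdot>\<^sub>v v) :: real ^ 'n) = a *\<^sub>R of_vec v"
  using assms by (simp add: Finite_Cartesian_Product.vec_eq_iff of_vec_def to_nat_on_less_CARD)

lemma vec_measurable_of_vec:
  assumes "vec_measurable CARD('n) M F"
  shows "(\<lambda>x. (of_vec (F x) :: real ^ 'n) $ j) \<in> borel_measurable M"
  using assms by (simp add: vec_measurable_def of_vec_def to_nat_on_less_CARD)

section \<open>Telescoping and the four assertions\<close>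

lemma grade_error_sum:
  "f x = (\<Sum>i=1..l. learned \<sigma> k W b i x) + grade_error \<sigma> k W b f l x"
  by (induction l) (auto simp: algebra_simps)

theorem theorem4p4:
  fixes D :: "(real ^ 's) set"
    and f :: "real ^ 's \<Rightarrow> real ^ 't"
    and \<sigma> :: "real \<Rightarrow> real"
    and k :: "nat \<Rightarrow> nat"
    and m :: "nat \<Rightarrow> nat \<Rightarrow> nat"
    and W :: "nat \<Rightarrow> nat \<Rightarrow> real mat"
    and b :: "nat \<Rightarrow> nat \<Rightarrow> real Matrix.vec"
  assumes "D \<in> sets lebesgue"
    and "\<sigma> \<in> borel_measurable borel"
    and "\<And>i. i \<ge> 1 \<Longrightarrow> k i \<ge> 1"
    and "\<And>i j. i \<ge> 1 \<Longrightarrow> j \<le> k i \<Longrightarrow> m i j \<ge> 1"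
    and "m 1 0 = CARD('s)"
    and "\<And>i. i \<ge> 2 \<Longrightarrow> m i 0 = CARD('t)"
    and "\<And>i. i \<ge> 1 \<Longrightarrow> m i (k i) = CARD('t)"
    and "f \<in> l2_space D"
    and "multigrade_model D \<sigma> k m f W b"
  shows "(\<forall>l\<ge>1. \<forall>x\<in>D. f x = (\<Sum>i=1..l. learned \<sigma> k W b i x) + grade_error \<sigma> k W b f l x)
    \<and> (\<forall>i\<ge>1. (l2norm D (grade_error \<sigma> k W b f i))\<^sup>2 \<ge>
         (l2norm D (learned \<sigma> k W b (i + 1) :: real ^ 's \<Rightarrow> real ^ 't))\<^sup>2
         + (l2norm D (grade_error \<sigma> k W b f (i + 1)))\<^sup>2)
    \<and> ((\<forall>i\<ge>1. l2norm D (grade_error \<sigma> k W b f (i + 1)) \<le> l2norm D (grade_error \<sigma> k W b f i))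
       \<and> (\<exists>L::real. L \<ge> 0 \<and> (\<lambda>i. l2norm D (grade_error \<sigma> k W b f i)) \<longlonglongrightarrow> ennreal L))
    \<and> (\<forall>i\<ge>1. (AE x in lebesgue_on D. (learned \<sigma> k W b (i + 1) x :: real ^ 't) = 0)
         \<or> l2norm D (grade_error \<sigma> k W b f (i + 1)) < l2norm D (grade_error \<sigma> k W b f i))"
proof -
  let ?e = "grade_error \<sigma> k W b f"
  let ?h = "learned \<sigma> k W b :: nat \<Rightarrow> real ^ 's \<Rightarrow> real ^ 't"
  let ?M = "lebesgue_on D"
  have par: "network_params (k (Suc i)) (m (Suc i)) (W (Suc i)) (b (Suc i))" for i
    using assms(9) by (simp add: multigrade_model_def)
  have min: "network_params (k (Suc i)) (m (Suc i)) V c \<Longrightarrow>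
      grade_loss D \<sigma> k W b f i (W (Suc i)) (b (Suc i)) \<le> grade_loss D \<sigma> k W b f i V c" for i V c
    using assms(9) by (simp add: multigrade_model_def)
  \<comment> \<open>The width is expressed as the input width of grade \<open>Suc i\<close>, which
    covers both \<open>CARD('s)\<close> before the first grade and \<open>CARD('t)\<close> after any
    grade.\<close>
  have chain_meas: "vec_measurable (m (Suc i) 0) ?M (\<lambda>x. net_chain \<sigma> k W b i (to_vec x))" for i
  proof (induction i)
    case 0
    thus ?case using assms(5) vec_measurable_to_vec[where 'n='s] by simp
  next
    case (Suc i)
    have "vec_measurable (m (Suc i) (k (Suc i))) ?M (\<lambda>x. net_chain \<sigma> k W b (Suc i) (to_vec x))"
      using vec_measurable_network[OF assms(2) par Suc] assms(3) by simp
    thus ?case using assms(6,7) by simp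
  qed
  have out: "vec_measurable CARD('t) ?M (\<lambda>x. net_chain \<sigma> k W b (Suc i) (to_vec x))" for i
    using chain_meas[of "Suc i"] assms(6) by simp
  have h_meas: "(\<lambda>x. ?h (Suc i) x $ j) \<in> borel_measurable ?M" for i j
    unfolding learned_def by (rule vec_measurable_of_vec[OF out])
  have e_meas: "(\<lambda>x. ?e i x $ j) \<in> borel_measurable ?M" for i j
  proof (induction i)
    case 0
    have "f \<in> borel_measurable ?M" using assms(8) by (simp add: l2_space_def)
    moreover have "(\<lambda>y. y $ j) \<in> borel_measurable (borel :: (real ^ 't) measure)"
      by (intro borel_measurable_continuous_onI continuous_intros)
    ultimately show ?case by (simp add: measurable_compose[where g = "\<lambda>y. y $ j"])
  next
    case (Suc i)
    thus ?case using h_meas[of i j] by simp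
  qed
  \<comment> \<open>The multiple \<open>a *\<^sub>R ?h (Suc i)\<close> is realized by a network of
    the same widths, so the minimality of the grade loss applies to it.\<close>
  have opt: "sq_integral D (\<lambda>x. ?e i x - ?h (Suc i) x) \<le> sq_integral D (\<lambda>x. ?e i x - a *\<^sub>R ?h (Suc i) x)"
    for i a
  proof -
    obtain V c where Vc: "network_params (k (Suc i)) (m (Suc i)) V c"
      and scale: "\<And>z. z \<in> carrier_vec (m (Suc i) 0) \<Longrightarrow>
        network \<sigma> (k (Suc i)) V c z = a \<cdot>\<^sub>v network \<sigma> (k (Suc i)) (W (Suc i)) (b (Suc i)) z"
      using network_scale[OF par, of i \<sigma> a] assms(3) by auto
    have "of_vec (network \<sigma> (k (Suc i)) V c (net_chain \<sigma> k W b i (to_vec x))) = a *\<^sub>R ?h (Suc i) x" for x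
      using out[of i] chain_meas[of i] by (simp add: vec_measurable_def learned_def scale of_vec_smult)
    thus ?thesis using min[OF Vc] by (simp add: grade_loss_def l2norm_power2 learned_def)
  qed
  \<comment> \<open>The errors start at \<open>f\<close> in L2, and comparison with the zero network
    (\<open>a = 0\<close>) keeps each next one finite.\<close>
  have fin: "sq_integral D (?e i) < \<infinity>" for i
  proof (induction i)
    case 0
    show ?case
      using assms(8) l2norm_finite_iff[of D f] by (simp add: l2_space_def less_top)
  next
    case (Suc i)
    thus ?case using opt[of i 0] by (simp add: le_less_trans)
  qed
  have pyth: "sq_integral D (?h (Suc i)) + sq_integral D (?e (Suc i)) \<le> sq_integral D (?e i)" for i
    using sq_integral_pythagoras_le[OF e_meas h_meas fin opt] by simp
  have mono: "l2norm D (?e (Suc i)) \<le> l2norm D (?e i)" for i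
    using opt[of i 0] by (simp add: l2norm_le_iff)
  \<comment> \<open>A decreasing sequence tends to its infimum, which is real because the norm of
    \<open>f\<close> bounds it.\<close>
  have "decseq (\<lambda>i. l2norm D (?e i))" using mono by (simp add: decseq_Suc_iff)
  hence lim: "(\<lambda>i. l2norm D (?e i)) \<longlonglongrightarrow> (INF i. l2norm D (?e i))" by (rule LIMSEQ_INF)
  have "(INF i. l2norm D (?e i)) \<le> l2norm D (?e 0)" by (rule INF_lower) simp
  hence "(INF i. l2norm D (?e i)) < \<infinity>"
    using fin[of 0] l2norm_finite_iff[of D f] by (auto simp: less_top intro: le_less_trans)
  hence "\<exists>L::real. L \<ge> 0 \<and> (\<lambda>i. l2norm D (?e i)) \<longlonglongrightarrow> ennreal L"
    using lim by (cases "INF i. l2norm D (?e i)") auto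
  moreover have "(AE x in ?M. ?h (Suc i) x = 0) \<or> l2norm D (?e (Suc i)) < l2norm D (?e i)" for i
  proof (cases "sq_integral D (?h (Suc i)) = 0")
    case True
    thus ?thesis using sq_integral_eq_0_imp_AE[OF h_meas] by blast
  next
    case False
    \<comment> \<open>Adding the new error preserves strictness because its integral is finite;
      \<open>pyth\<close> then makes the drop in error strict.\<close>
    have "0 + sq_integral D (?e (Suc i)) < sq_integral D (?h (Suc i)) + sq_integral D (?e (Suc i))"
      using False fin[of "Suc i"] unfolding add.commute[of _ "sq_integral D (?e (Suc i))"]
      by (simp add: ennreal_add_left_cancel_less zero_less_iff_neq_zero less_top)
    also note pyth
    finally show ?thesis by (simp add: l2norm_less_iff)
  qed
  ultimately show ?thesis
    using grade_error_sum[where f=f] pyth mono by (simp add: l2norm_power2)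
qed

end
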